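(* Let $X$ be a $T_1$ space and let $\mathbb{P}$ be a cap-basis of $X$. Then the map \[x\mapsto x^\in=\{p\in\mathbb{P}:x\in p\}\] is a homeomorphism from $X$ onto the spectrum $\mathsf{S}\mathbb{P}$ of the poset $(\mathbb{P},\subseteq)$.
   Context: Let $(\mathbb{P},\leq)$ be a poset. A subset $S\subseteq\mathbb{P}$ refines $T\subseteq\mathbb{P}$ if for every $s\in S$ there is $t\in T$ with $s\leq t$. A band of $\mathbb{P}$ is a finite subset $B\subseteq\mathbb{P}$ such that every $p\in\mathbb{P}$ is comparable to some $b\in B$. A cap of $\mathbb{P}$ is a subset refined by some band. A selector is a subset $S\subseteq\mathbb{P}$ with $S\cap C\neq\emptyset$ for every cap $C$ of $\mathbb{P}$; a minimal selector is one minimal with respect to inclusion among all selectors. The spectrum $\mathsf{S}\mathbb{P}$ is the set of all minimal selectors, with the topology generated by the subbasis consisting of the sets $p^\in=\{S\in\mathsf{S}\mathbb{P}:p\in S\}$, for $p\in\mathbb{P}$. A basis $\mathbb{P}$ of a topological space $X$, ordered by inclusion, is a cap-basis if for all $C\subseteq\mathbb{P}$, $C$ is a cap of $\mathbb{P}$ if and only if $X=\bigcup C$. *)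

theory Defs
  imports "HOL-Analysis.Analysis"
begin

text \<open>
  A poset is given by a carrier set \<open>P\<close> and a relation \<open>le\<close>, which is only ever
  inspected on \<open>P\<close>.
\<close>

definition refines :: "('a \<Rightarrow> 'a \<Rightarrow> bool) \<Rightarrow> 'a set \<Rightarrow> 'a set \<Rightarrow> bool" where
  "refines le S T \<longleftrightarrow> (\<forall>s\<in>S. \<exists>t\<in>T. le s t)"

definition band :: "'a set \<Rightarrow> ('a \<Rightarrow> 'a \<Rightarrow> bool) \<Rightarrow> 'a set \<Rightarrow> bool" where
  "band P le B \<longleftrightarrow> B \<subseteq> P \<and> finite B \<and> (\<forall>p\<in>P. \<exists>b\<in>B. le p b \<or> le b p)"

definition cap :: "'a set \<Rightarrow> ('a \<Rightarrow> 'a \<Rightarrow> bool) \<Rightarrow> 'a set \<Rightarrow> bool" where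
  "cap P le C \<longleftrightarrow> C \<subseteq> P \<and> (\<exists>B. band P le B \<and> refines le B C)"

definition selector :: "'a set \<Rightarrow> ('a \<Rightarrow> 'a \<Rightarrow> bool) \<Rightarrow> 'a set \<Rightarrow> bool" where
  "selector P le S \<longleftrightarrow> S \<subseteq> P \<and> (\<forall>C. cap P le C \<longrightarrow> S \<inter> C \<noteq> {})"

definition minimal_selector :: "'a set \<Rightarrow> ('a \<Rightarrow> 'a \<Rightarrow> bool) \<Rightarrow> 'a set \<Rightarrow> bool" where
  "minimal_selector P le S \<longleftrightarrow>
     selector P le S \<and> (\<forall>T. selector P le T \<and> T \<subseteq> S \<longrightarrow> T = S)"

definition spectrum :: "'a set \<Rightarrow> ('a \<Rightarrow> 'a \<Rightarrow> bool) \<Rightarrow> 'a set set" where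
  "spectrum P le = {S. minimal_selector P le S}"

text \<open>
  \<open>relative_to\<close> makes the whole spectrum the empty intersection, and hence the underlying
  set of the topology, even if the subbasic sets fail to cover it: in a poset without
  bands the empty set is the only minimal selector and lies in no subbasic set. This is
  why \<^const>\<open>topology_generated_by\<close>, whose underlying set is the union of
  the generators, is not used.
\<close>

definition spectrum_topology :: "'a set \<Rightarrow> ('a \<Rightarrow> 'a \<Rightarrow> bool) \<Rightarrow> 'a set topology" where
  "spectrum_topology P le =
     topology (arbitrary union_of
       (finite intersection_of (\<lambda>U. \<exists>p\<in>P. U = {S \<in> spectrum P le. p \<in> S})
         relative_to spectrum P le))"

definition basis_of :: "'a topology \<Rightarrow> 'a set set \<Rightarrow> bool" where
  "basis_of X P \<longleftrightarrow> openin X = arbitrary union_of (\<lambda>U. U \<in> P)"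

definition cap_basis :: "'a topology \<Rightarrow> 'a set set \<Rightarrow> bool" where
  "cap_basis X P \<longleftrightarrow>
     basis_of X P \<and> (\<forall>C. C \<subseteq> P \<longrightarrow> (cap P (\<subseteq>) C \<longleftrightarrow> topspace X = \<Union>C))"

end

theory Submission
  imports Defs
begin

text \<open>
  For a point \<open>x\<close>, let its trace be the family of basic sets that contain \<open>x\<close>. In a cap-basis
  the caps are exactly the basic covers, so being a selector means meeting every basic cover.
  Traces do this trivially. Conversely, if a family of basic sets contains no trace, then every
  point lies in a basic set outside the family, so the basic sets outside the family form a
  cover, that is, a cap which the family misses (\<open>selector_contains_trace\<close>). Selectors are thus
  precisely the families of basic sets that contain a trace, and minimal selectors are precisely
  the minimal traces. In a \<open>T\<^sub>1\<close> space distinct traces are incomparable, so every trace is minimal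
  and \<open>x\<close> is determined by its trace (\<open>spectrum_eq_traces\<close>).

  The resulting bijection from the space to the spectrum matches each basic set \<open>p\<close> with the
  subbasic set of selectors containing \<open>p\<close>. It therefore matches the basis with a subbasis and is
  a homeomorphism.
\<close>

lemma topspace_spectrum_topology [simp]:
  "topspace (spectrum_topology P le) = spectrum P le"
  unfolding spectrum_topology_def by (rule topspace_subbase)

lemma openin_spectrum_topology_subbasic:
  assumes "p \<in> P"
  shows "openin (spectrum_topology P le) {S \<in> spectrum P le. p \<in> S}"
  unfolding spectrum_topology_def openin_subbase
  using assms
  by (intro arbitrary_union_of_inc relative_to_subset_inc finite_intersection_of_inc) auto

lemma continuous_map_into_spectrum_topology:
  assumes "f \<in> topspace X \<rightarrow> spectrum P le"
    and "\<And>p. p \<in> P \<Longrightarrow> openin X {x \<in> topspace X. p \<in> f x}"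
  shows "continuous_map X (spectrum_topology P le) f"
  unfolding spectrum_topology_def
proof (rule continuous_map_into_topology_subbase, goal_cases)
  case (1 x)
  then show ?case using assms(1) by auto
next
  case (2 U)
  then obtain p where "p \<in> P" and U: "U = {S \<in> spectrum P le. p \<in> S}"
    by blast
  moreover have "{x \<in> topspace X. f x \<in> U} = {x \<in> topspace X. p \<in> f x}"
    using assms(1) U by blast
  ultimately show ?case using assms(2) by simp
qed

lemma basis_of_openin: "basis_of X P \<Longrightarrow> p \<in> P \<Longrightarrow> openin X p"
  by (simp add: basis_of_def arbitrary_union_of_inc)

lemma basis_of_obtain:
  assumes "basis_of X P" "openin X U" "x \<in> U"
  obtains p where "p \<in> P" "x \<in> p" "p \<subseteq> U"
  using assms unfolding basis_of_def by (force simp: arbitrary_union_of_alt)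

lemma trace_selector:
  assumes "cap_basis X P" "x \<in> topspace X"
  shows "selector P (\<subseteq>) {p \<in> P. x \<in> p}"
proof -
  have "{p \<in> P. x \<in> p} \<inter> C \<noteq> {}" if "cap P (\<subseteq>) C" for C
  proof -
    have "C \<subseteq> P"
      using that by (simp add: cap_def)
    then have "topspace X = \<Union>C"
      using that assms(1) unfolding cap_basis_def by blast
    then show ?thesis
      using assms(2) \<open>C \<subseteq> P\<close> by blast
  qed
  then show ?thesis by (simp add: selector_def)
qed

text \<open>
  A cover of the space is a cap, so a selector cannot miss one. The basic sets outside a selector
  therefore leave some point uncovered, which means that every basic set around this point
  belongs to the selector.
\<close>

lemma selector_contains_trace:
  assumes cb: "cap_basis X P" and "selector P (\<subseteq>) S"
  obtains x where "x \<in> topspace X" "{p \<in> P. x \<in> p} \<subseteq> S"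
proof -
  have "\<not> cap P (\<subseteq>) (P - S)"
    using assms(2) unfolding selector_def by blast
  then have "topspace X \<noteq> \<Union>(P - S)"
    using cb unfolding cap_basis_def by blast
  moreover have "\<Union>(P - S) \<subseteq> topspace X"
    using cb basis_of_openin[THEN openin_subset] unfolding cap_basis_def by blast
  ultimately show thesis
    using that by blast
qed

text \<open>
  If \<open>y \<noteq> x\<close>, the \<open>T\<^sub>1\<close> axiom gives a basic set around \<open>y\<close> that misses \<open>x\<close>. This
  one-sided separation excludes even a proper inclusion of traces, whence both the minimality of
  traces as selectors and the injectivity of the trace map.
\<close>

lemma trace_subset_imp_eq:
  assumes "t1_space X" and basis: "basis_of X P" and "x \<in> topspace X" "y \<in> topspace X"
    and sub: "{p \<in> P. y \<in> p} \<subseteq> {p \<in> P. x \<in> p}"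
  shows "y = x"
proof (rule ccontr)
  assume "y \<noteq> x"
  then obtain U where "openin X U" "y \<in> U" "x \<notin> U"
    using assms unfolding t1_space_def by metis
  then show False
    using sub basis_of_obtain[OF basis] by blast
qed

text \<open>
  A minimal selector contains a trace, which is itself a selector, and so equals it. Conversely,
  a selector inside the trace of \<open>x\<close> contains the trace of some \<open>y\<close>, and the \<open>T\<^sub>1\<close> axiom forces
  \<open>y = x\<close>, so nothing smaller than the trace of \<open>x\<close> is a selector.
\<close>

lemma spectrum_eq_traces:
  assumes t1: "t1_space X" and cb: "cap_basis X P"
  shows "spectrum P (\<subseteq>) = (\<lambda>x. {p \<in> P. x \<in> p}) ` topspace X"
proof (intro equalityI subsetI)
  fix S assume "S \<in> spectrum P (\<subseteq>)"
  then have S: "minimal_selector P (\<subseteq>) S"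
    by (simp add: spectrum_def)
  then obtain x where "x \<in> topspace X" "{p \<in> P. x \<in> p} \<subseteq> S"
    using selector_contains_trace[OF cb] unfolding minimal_selector_def by blast
  with S trace_selector[OF cb] show "S \<in> (\<lambda>x. {p \<in> P. x \<in> p}) ` topspace X"
    unfolding minimal_selector_def by blast
next
  fix S assume "S \<in> (\<lambda>x. {p \<in> P. x \<in> p}) ` topspace X"
  then obtain x where x: "x \<in> topspace X" and S: "S = {p \<in> P. x \<in> p}"
    by blast
  have "T = S" if "selector P (\<subseteq>) T" and "T \<subseteq> S" for T
  proof -
    obtain y where y: "y \<in> topspace X" and yT: "{p \<in> P. y \<in> p} \<subseteq> T"
      using selector_contains_trace[OF cb \<open>selector P (\<subseteq>) T\<close>] .
    have "y = x"
    proof (rule trace_subset_imp_eq[OF t1 _ x y])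
      show "basis_of X P"
        using cb by (simp add: cap_basis_def)
      show "{p \<in> P. y \<in> p} \<subseteq> {p \<in> P. x \<in> p}"
        using yT \<open>T \<subseteq> S\<close> S by (rule order.trans[OF _ ord_le_eq_trans])
    qed
    then show ?thesis
      using yT \<open>T \<subseteq> S\<close> S by (intro equalityI) simp_all
  qed
  then show "S \<in> spectrum P (\<subseteq>)"
    using trace_selector[OF cb x] S by (simp add: spectrum_def minimal_selector_def)
qed

theorem proposition2p9:
  fixes X :: "'a topology" and P :: "'a set set"
  assumes "t1_space X" and "cap_basis X P"
  shows "homeomorphic_map X (spectrum_topology P (\<subseteq>)) (\<lambda>x. {p \<in> P. x \<in> p})"
proof (rule bijective_open_imp_homeomorphic_map)
  let ?tr = "\<lambda>x. {p \<in> P. x \<in> p}" and ?S = "spectrum P (\<subseteq>)"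
  have basis: "basis_of X P"
    using assms(2) by (simp add: cap_basis_def)
  have range: "?tr ` topspace X = ?S"
    using spectrum_eq_traces[OF assms] by simp
  have sub: "p \<subseteq> topspace X" if "p \<in> P" for p
    using basis_of_openin[OF basis that] by (rule openin_subset)
  show "?tr ` topspace X = topspace (spectrum_topology P (\<subseteq>))"
    using range by simp
  show "inj_on ?tr (topspace X)"
    by (rule inj_onI, rule trace_subset_imp_eq[OF assms(1) basis]) auto
  show "continuous_map X (spectrum_topology P (\<subseteq>)) ?tr"
  proof (rule continuous_map_into_spectrum_topology)
    show "?tr \<in> topspace X \<rightarrow> ?S"
      using range by blast
    fix p assume "p \<in> P"
    then have "{x \<in> topspace X. p \<in> ?tr x} = p"
      using sub by blast
    then show "openin X {x \<in> topspace X. p \<in> ?tr x}"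
      using basis_of_openin[OF basis \<open>p \<in> P\<close>] by simp
  qed
  show "open_map X (spectrum_topology P (\<subseteq>)) ?tr"
    unfolding open_map_def
  proof (intro allI impI)
    fix U assume "openin X U"
    then obtain \<U> where "\<U> \<subseteq> P" and U: "U = \<Union>\<U>"
      using basis by (auto simp: basis_of_def arbitrary_union_of_alt union_of_def)
    \<comment> \<open>Surjectivity onto the spectrum turns the image of a basic set into a subbasic set.\<close>
    have "?tr ` p = {S \<in> ?S. p \<in> S}" if "p \<in> P" for p
      using sub[OF that] that unfolding range[symmetric] by blast
    then have "openin (spectrum_topology P (\<subseteq>)) (?tr ` p)" if "p \<in> \<U>" for p
      using subsetD[OF \<open>\<U> \<subseteq> P\<close> that] by (simp add: openin_spectrum_topology_subbasic)
    then have "openin (spectrum_topology P (\<subseteq>)) (\<Union>p\<in>\<U>. ?tr ` p)"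
      by (intro openin_Union) (erule imageE, simp only:)
    then show "openin (spectrum_topology P (\<subseteq>)) (?tr ` U)"
      by (simp only: U image_Union)
  qed
qed

end
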